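(* Suppose the weight of edges may be increased by arbitrary (nonnegative) rational amounts. Then for every $n\in\mathbb{N}$ there exist a directed graph $G$ with $n$ vertices, a weight function $w:E(G)\to\mathbb{Z}$ and a source vertex $s$ such that every $1$-WTSS of $G$ in this model (with respect to $s$) must contain at least $c\cdot n^2$ edges, for some constant $c>0$.
   Context: For a directed graph $G$ with edge weights $w$, $dist_{G,w}(x,y)$ is the minimum weight of an $x$–$y$ path. In this model, given $G$, $w:E(G)\to\mathbb{Z}$, a source $s$ and $k\ge 1$, a subgraph $H=(V(G),E')$ with $E'\subseteq E(G)$ is a $k$-WTSS of $G$ if for every increment function $I:E(G)\to\mathbb{Q}_{\ge 0}$ with $\sum_{e\in E(G)} I(e)\le k$, setting $w'(e)=w(e)+I(e)$, one has $dist_{G,w'}(s,t)=dist_{H,w'}(s,t)$ for every $t\in V(G)$.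
   Formalization: The claim is proved for every n ≥ 2 rather than every n: for n = 0 there is no source vertex, and for n = 1 the subgraph without edges is a 1-WTSS, so the bound c·n² with c > 0 fails. *)

theory Defs
  imports "Graph_Theory.Graph_Theory" "HOL-Library.Extended_Real"
begin

text \<open>
  The minimum weight of an \<open>x\<close>--\<open>y\<close> path. Paths are simple (\<open>apath\<close>), so that in a finite
  digraph the minimum exists as soon as \<open>y\<close> is reachable from \<open>x\<close>, whatever the signs of the
  weights (the walk-based \<open>wf_digraph.\<mu>\<close> is \<open>-\<infinity>\<close> in the presence of negative cycles; without
  negative cycles the two notions agree). If there is no path, the distance is \<open>\<infinity>\<close>.
\<close>

definition wdist :: "('a, 'b) pre_digraph \<Rightarrow> ('b \<Rightarrow> rat) \<Rightarrow> 'a \<Rightarrow> 'a \<Rightarrow> ereal" where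
  "wdist G w x y = (INF p \<in> {p. pre_digraph.apath G x p y}. ereal (of_rat (\<Sum>e\<leftarrow>p. w e)))"

lemma wdist_unreachable:
  assumes "\<nexists>p. pre_digraph.apath G x p y"
  shows "wdist G w x y = \<infinity>"
  using assms by (simp add: wdist_def top_ereal_def)

lemma (in fin_digraph) wdist_attained:
  assumes "apath x q y"
  obtains p where "apath x p y" "wdist G w x y = ereal (of_rat (\<Sum>e\<leftarrow>p. w e))"
    "\<And>p'. apath x p' y \<Longrightarrow> (\<Sum>e\<leftarrow>p. w e) \<le> (\<Sum>e\<leftarrow>p'. w e)"
proof -
  let ?P = "{p. apath x p y}" and ?c = "\<lambda>p. \<Sum>e\<leftarrow>p. w e"
  have "?P \<subseteq> (fst \<circ> snd) ` {(u, p, v). apath u p v}"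
  proof
    fix p assume "p \<in> ?P"
    then show "p \<in> (fst \<circ> snd) ` {(u, p, v). apath u p v}"
      by (intro image_eqI[where x = "(x, p, y)"]) simp_all
  qed
  then have fin: "finite ?P"
    by (rule finite_subset) (intro finite_imageI apaths_finite_triple)
  have "?P \<noteq> {}" using assms by blast
  define p where "p = arg_min_on ?c ?P"
  have p: "p \<in> ?P" "?c p \<le> ?c p'" if "p' \<in> ?P" for p'
    unfolding p_def using arg_min_if_finite(1)[OF fin \<open>?P \<noteq> {}\<close>, of ?c]
      arg_min_least[OF fin \<open>?P \<noteq> {}\<close> that, of ?c] by simp_all
  have "wdist G w x y = ereal (of_rat (?c p))"
    unfolding wdist_def
  proof (rule antisym)
    show "(INF p \<in> ?P. ereal (of_rat (?c p))) \<le> ereal (of_rat (?c p))"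
      using p(1) assms by (intro INF_lower) simp
    show "ereal (of_rat (?c p)) \<le> (INF p \<in> ?P. ereal (of_rat (?c p)))"
      by (rule INF_greatest) (use p(2) in \<open>simp add: of_rat_less_eq\<close>)
  qed
  moreover have "apath x p y" using p(1) assms by simp
  ultimately show thesis using p(2) by (intro that[of p]) simp_all
qed

definition is_WTSS ::
  "nat \<Rightarrow> ('a, 'b) pre_digraph \<Rightarrow> ('b \<Rightarrow> int) \<Rightarrow> 'a \<Rightarrow> ('a, 'b) pre_digraph \<Rightarrow> bool" where
  "is_WTSS k G w s H \<longleftrightarrow>
     spanning H G \<and>
     (\<forall>I :: 'b \<Rightarrow> rat. (\<forall>e \<in> arcs G. 0 \<le> I e) \<and> (\<Sum>e \<in> arcs G. I e) \<le> of_nat k \<longrightarrow>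
        (let w' = (\<lambda>e. of_int (w e) + I e)
         in \<forall>t \<in> verts G. wdist G w' s t = wdist H w' s t))"

end

theory Submission
  imports Defs
begin

text \<open>
  All weights are zero. The source \<open>0\<close> has arcs to \<open>1, \<dots>, m - 1\<close>, and there is a complete
  bipartite graph from \<open>{0..<m}\<close> to \<open>{m..<n}\<close>, where \<open>m = n div 2\<close>. To see that the arc
  \<open>(i, b)\<close> of the bipartite part cannot be dropped, raise every arc leaving \<open>0\<close>, except
  \<open>(0, i)\<close> and \<open>(i, b)\<close>, by \<open>1/n\<close>: this costs at most \<open>1\<close> in total, and then the only path
  of weight \<open>0\<close> from \<open>0\<close> to \<open>b\<close> is the one through \<open>i\<close> that ends with \<open>(i, b)\<close>.
\<close>

definition hard_arcs :: "nat \<Rightarrow> nat \<Rightarrow> (nat \<times> nat) set" where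
  "hard_arcs m n = {0} \<times> {1..<m} \<union> {0..<m} \<times> {m..<n}"

definition hard_graph :: "nat \<Rightarrow> nat \<Rightarrow> (nat, nat \<times> nat) pre_digraph" where
  "hard_graph m n = \<lparr>verts = {0..<n}, arcs = hard_arcs m n, tail = fst, head = snd\<rparr>"

lemma hard_graph_simps [simp]:
  "verts (hard_graph m n) = {0..<n}"
  "arcs (hard_graph m n) = hard_arcs m n"
  "tail (hard_graph m n) = fst"
  "head (hard_graph m n) = snd"
  by (simp_all add: hard_graph_def)

lemma finite_hard_arcs [simp]: "finite (hard_arcs m n)"
  by (simp add: hard_arcs_def)

lemma digraph_hard_graph:
  assumes "m \<le> n"
  shows "digraph (hard_graph m n)"
  using assms
  by unfold_locales (auto simp: hard_arcs_def arc_to_ends_def)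

text \<open>The exemption of \<open>(0, i)\<close> acts when i > 0 and that of \<open>(i, b)\<close>
  when i = 0, so one formula covers both cases.\<close>

definition probe :: "nat \<Rightarrow> nat \<Rightarrow> nat \<Rightarrow> nat \<times> nat \<Rightarrow> rat" where
  "probe n i b e = (if fst e = 0 \<and> e \<noteq> (0, i) \<and> e \<noteq> (i, b) then 1 / of_nat n else 0)"

lemma probe_nonneg: "0 \<le> probe n i b e"
  by (simp add: probe_def)

text \<open>At most n arcs leave \<open>0\<close>, one per head. Fractional increments let a budget
  of 1 raise them all.\<close>

lemma sum_probe_le:
  assumes "m \<le> n"
  shows "(\<Sum>e\<in>hard_arcs m n. probe n i b e) \<le> 1"
proof -
  let ?E = "{e \<in> hard_arcs m n. fst e = 0}"
  have "?E \<subseteq> Pair 0 ` {0..<n}"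
    using assms by (force simp: hard_arcs_def)
  then have "card ?E \<le> n"
    using surj_card_le[of "{0..<n}" ?E "Pair 0"] by simp
  have "(\<Sum>e\<in>hard_arcs m n. probe n i b e)
      \<le> (\<Sum>e\<in>hard_arcs m n. if fst e = 0 then 1 / of_nat n else 0)"
    by (intro sum_mono) (simp add: probe_def)
  also have "\<dots> = of_nat (card ?E) / of_nat n"
    by (simp add: sum.If_cases Int_def)
  \<comment> \<open>For n = 0 the quotient is 0 by the convention on division by zero.\<close>
  also have "\<dots> \<le> 1"
    using \<open>card ?E \<le> n\<close> by (auto simp: divide_le_eq_1)
  finally show ?thesis .
qed

lemma wdist_hard_graph_le:
  assumes "i < m" "m \<le> b" "b < n"
  shows "wdist (hard_graph m n) (probe n i b) 0 b \<le> 0"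
proof -
  interpret digraph "hard_graph m n"
    using assms by (intro digraph_hard_graph) simp
  \<comment> \<open>For i = 0 the source is already at i, and the two-arc form would start with a
    loop.\<close>
  define p where "p = (if i = 0 then [(0, b)] else [(0, i), (i, b)])"
  have "apath 0 p b"
    using assms
    by (auto simp: p_def apath_def awalk_def hard_arcs_def pre_digraph.cas.simps)
  then have "wdist (hard_graph m n) (probe n i b) 0 b
      \<le> ereal (of_rat (\<Sum>e\<leftarrow>p. probe n i b e))"
    unfolding wdist_def by (intro INF_lower) simp
  also have "(\<Sum>e\<leftarrow>p. probe n i b e) = 0"
    by (simp add: p_def probe_def)
  finally show ?thesis by (simp add: zero_ereal_def)
qed

text \<open>A first arc other than \<open>(0, i)\<close> already costs 1/n, and the rest is
  nonnegative. After \<open>(0, i)\<close>, with \<open>(i, b)\<close> forbidden, the walk must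
  enter some \<open>y\<close> at or above m other than b; such a vertex has no outgoing arc, so b is
  never reached.\<close>

lemma probe_weight_ge:
  assumes "pre_digraph.cas (hard_graph m n) 0 p b" "set p \<subseteq> hard_arcs m n - {(i, b)}"
    and "i < m" "m \<le> b"
  shows "1 / of_nat n \<le> (\<Sum>e\<leftarrow>p. probe n i b e)"
proof -
  note cas = pre_digraph.cas.simps
  from assms obtain x p' where p: "p = (0, x) # p'"
    by (cases p) (auto simp: cas)
  have "x \<noteq> i"
  proof
    assume "x = i"
    with p assms obtain y p'' where p': "p' = (i, y) # p''"
      by (cases p') (auto simp: cas)
    with p assms \<open>x = i\<close> have "m \<le> y" "y \<noteq> b"
      by (auto simp: hard_arcs_def)
    with p p' assms obtain z q where "p'' = (y, z) # q"
      by (cases p'') (auto simp: cas)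
    with p p' assms \<open>m \<le> y\<close> show False
      by (auto simp: hard_arcs_def)
  qed
  then have "probe n i b (0, x) = 1 / of_nat n"
    using p assms by (auto simp: probe_def)
  moreover have "0 \<le> (\<Sum>e\<leftarrow>p'. probe n i b e)"
    by (intro sum_list_nonneg) (auto simp: probe_nonneg)
  ultimately show ?thesis
    by (simp add: p)
qed

lemma WTSS_hard_graph_arc:
  assumes H: "is_WTSS 1 (hard_graph m n) (\<lambda>_. 0) 0 H"
    and ib: "i < m" "m \<le> b" "b < n"
  shows "(i, b) \<in> arcs H"
proof (rule ccontr)
  assume notin: "(i, b) \<notin> arcs H"
  let ?G = "hard_graph m n"
  from H have span: "spanning H ?G"
    by (simp add: is_WTSS_def)
  then have arcs: "arcs H \<subseteq> hard_arcs m n" and compat: "compatible ?G H"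
    by (auto simp: spanning_def subgraph_def)
  have "wdist ?G (probe n i b) 0 b = wdist H (probe n i b) 0 b"
    using H ib sum_probe_le[of m n i b] probe_nonneg[of n i b]
    unfolding is_WTSS_def Let_def by (auto dest!: spec[of _ "probe n i b"])
  \<comment> \<open>This includes the case where b is unreachable in \<open>H\<close>: the infimum
    is then infinite.\<close>
  moreover have "ereal (of_rat (1 / of_nat n)) \<le> wdist H (probe n i b) 0 b"
    unfolding wdist_def
  proof (rule INF_greatest)
    fix p assume "p \<in> {p. pre_digraph.apath H 0 p b}"
    then have "pre_digraph.cas H 0 p b" "set p \<subseteq> arcs H"
      by (simp_all add: pre_digraph.apath_def pre_digraph.awalk_def)
    \<comment> \<open>\<open>cas\<close> reads only tails and heads, on which \<open>H\<close> and
      the graph agree.\<close>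
    then have "pre_digraph.cas ?G 0 p b" "set p \<subseteq> hard_arcs m n - {(i, b)}"
      using compat arcs notin by (auto simp: compatible_cas)
    then have "1 / of_nat n \<le> (\<Sum>e\<leftarrow>p. probe n i b e)"
      using ib by (intro probe_weight_ge)
    then show "ereal (of_rat (1 / of_nat n)) \<le> ereal (of_rat (\<Sum>e\<leftarrow>p. probe n i b e))"
      by (simp only: ereal_less_eq of_rat_less_eq)
  qed
  ultimately have "ereal (of_rat (1 / of_nat n)) \<le> 0"
    using wdist_hard_graph_le[OF ib] by (metis order_trans)
  then show False
    using ib by (simp add: of_rat_divide)
qed

lemma card_WTSS_hard_graph_ge:
  assumes H: "is_WTSS 1 (hard_graph m n) (\<lambda>_. 0) 0 H"
  shows "m * (n - m) \<le> card (arcs H)"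
proof -
  have "arcs H \<subseteq> hard_arcs m n"
    using H by (auto simp: is_WTSS_def spanning_def subgraph_def)
  then have "finite (arcs H)"
    by (rule finite_subset) simp
  moreover have "{0..<m} \<times> {m..<n} \<subseteq> arcs H"
    using WTSS_hard_graph_arc[OF H] by auto
  ultimately have "card ({0..<m} \<times> {m..<n}) \<le> card (arcs H)"
    by (rule card_mono)
  then show ?thesis
    by (simp add: card_cartesian_product)
qed

text \<open>The bound starts at n = 2: a loop-free graph on one vertex has no arcs, and with no
  vertices there is no source.\<close>

theorem theorem6:
  shows "\<exists>c::real. c > 0 \<and>
    (\<forall>n::nat. n \<ge> 2 \<longrightarrow>
      (\<exists>(G :: (nat, nat \<times> nat) pre_digraph) (w :: nat \<times> nat \<Rightarrow> int) (s :: nat).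
         digraph G \<and> card (verts G) = n \<and> s \<in> verts G \<and>
         (\<forall>H. is_WTSS 1 G w s H \<longrightarrow> real (card (arcs H)) \<ge> c * (real n)\<^sup>2)))"
proof (intro exI[of _ "1/9"] conjI allI impI)
  fix n :: nat assume n: "n \<ge> 2"
  define m where "m = n div 2"
  have bound: "1 / 9 * (real n)\<^sup>2 \<le> real (card (arcs H))"
    if "is_WTSS 1 (hard_graph m n) (\<lambda>_. 0) 0 H" for H
  proof -
    \<comment> \<open>Each side of the bipartite part has at least n/3 vertices, tight for m at n =
      3; hence the constant 1/9.\<close>
    have "n \<le> 3 * m" "n \<le> 3 * (n - m)"
      using n unfolding m_def by presburger+
    then have "n * n \<le> (3 * m) * (3 * (n - m))"
      by (rule mult_le_mono)
    also have "\<dots> \<le> 9 * card (arcs H)"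
      using card_WTSS_hard_graph_ge[OF that] by simp
    finally have "real (n * n) \<le> real (9 * card (arcs H))"
      by (rule of_nat_mono)
    then show ?thesis
      by (simp add: power2_eq_square)
  qed
  show "\<exists>(G :: (nat, nat \<times> nat) pre_digraph) w s.
      digraph G \<and> card (verts G) = n \<and> s \<in> verts G \<and>
      (\<forall>H. is_WTSS 1 G w s H \<longrightarrow> 1 / 9 * (real n)\<^sup>2 \<le> real (card (arcs H)))"
    using n bound digraph_hard_graph[of m n]
    by (intro exI[of _ "hard_graph m n"] exI[of _ "\<lambda>_. 0"] exI[of _ 0])
      (simp add: m_def)
qed simp

end
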